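(* Define a function $f$ from compositions to natural numbers recursively as follows. For a composition $\lambda=(\lambda_1,\dots,\lambda_r)$ with translation parameters $s_i=\sum_{j>i}\lambda_j-\sum_{j<i}\lambda_j$, let $t$ be the smallest index in $\{1,\dots,r\}$ with $\lambda_t\ge|s_t|$, and set $$f(\lambda)=\begin{cases}\lambda_1 & \text{if } r=1,\\ \lambda_t+f(\lambda_1,\dots,\lambda_{t-1},\lambda_{t+1},\dots,\lambda_r) & \text{if } |s_t|=0,\\ f(\lambda_1,\dots,\lambda_{t-1},\lambda_{t+1},\dots,\lambda_r) & \text{if } \lambda_t=|s_t|,\\ f(\lambda_1,\dots,\lambda_{t-1},\lambda_t-|s_t|,\lambda_{t+1},\dots,\lambda_r) & \text{otherwise}\end{cases}$$ (the cases being tested in this order). Then $f$ is well defined and, for every composition $\lambda$, $f(\lambda)=\gamma(T_\lambda)$ is the number of orbits of the symmetric discrete interval exchange $T_\lambda$.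
   Context: A composition of $n$ is a finite sequence $(\lambda_1,\dots,\lambda_r)$ of positive integers with sum $n$. For $\llbracket a,b\rrbracket=[a,b]\cap\mathbb{Z}$, define $B_i=\llbracket 1+\sum_{j<i}\lambda_j,\ \sum_{j\le i}\lambda_j\rrbracket$ and $s_i=\sum_{j>i}\lambda_j-\sum_{j<i}\lambda_j$. The symmetric discrete interval exchange $T_\lambda$ is the permutation of $\llbracket 1,n\rrbracket$ given by $T_\lambda(x)=x+s_i$ for $x\in B_i$. $\gamma(\sigma)$ denotes the number of orbits of a permutation $\sigma$. *)

theory Defs
  imports "HOL-Combinatorics.Orbits"
begin

text \<open>
  Compositions are nonempty lists, with list positions counted from 0: the part
  \<open>\<lambda>\<^sub>i\<close> is \<open>lam ! (i - 1)\<close>.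
\<close>

definition composition :: "nat list \<Rightarrow> bool" where
  "composition lam \<longleftrightarrow> lam \<noteq> [] \<and> (\<forall>k\<in>set lam. 0 < k)"

definition block :: "nat list \<Rightarrow> nat \<Rightarrow> int set" where
  "block lam i = {1 + (\<Sum>j<i. int (lam ! j)) .. (\<Sum>j\<le>i. int (lam ! j))}"

definition shift :: "nat list \<Rightarrow> nat \<Rightarrow> int" where
  "shift lam i = (\<Sum>j\<in>{i<..<length lam}. int (lam ! j)) - (\<Sum>j<i. int (lam ! j))"

text \<open>The blocks partition \<open>{1..n}\<close>; outside of it the map is the identity.\<close>

definition interval_exchange :: "nat list \<Rightarrow> int \<Rightarrow> int" where
  "interval_exchange lam x =
     (if \<exists>i<length lam. x \<in> block lam i
      then x + shift lam (THE i. i < length lam \<and> x \<in> block lam i)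
      else x)"

definition num_orbits :: "'a set \<Rightarrow> ('a \<Rightarrow> 'a) \<Rightarrow> nat" where
  "num_orbits S \<sigma> = card (orbit \<sigma> ` S)"

definition pivot :: "nat list \<Rightarrow> nat" where
  "pivot lam = (LEAST t. t < length lam \<and> \<bar>shift lam t\<bar> \<le> int (lam ! t))"

definition delete_part :: "nat \<Rightarrow> nat list \<Rightarrow> nat list" where
  "delete_part t lam = take t lam @ drop (Suc t) lam"

text \<open>
  The recursion is introduced without a termination proof. The relation
  \<open>comp_f_rel mu lam\<close> says that evaluating \<open>comp_f lam\<close> calls \<open>comp_f mu\<close>, and
  \<open>comp_f_dom lam\<close> that the evaluation at \<open>lam\<close> terminates; the defining
  equation (\<open>comp_f.psimps\<close>) is available only on this domain.
\<close>

function (domintros) comp_f :: "nat list \<Rightarrow> nat" where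
  "comp_f lam =
     (if length lam = 1 then lam ! 0
      else if \<bar>shift lam (pivot lam)\<bar> = 0
        then lam ! pivot lam + comp_f (delete_part (pivot lam) lam)
      else if int (lam ! pivot lam) = \<bar>shift lam (pivot lam)\<bar>
        then comp_f (delete_part (pivot lam) lam)
      else comp_f (lam[pivot lam := lam ! pivot lam - nat \<bar>shift lam (pivot lam)\<bar>]))"
  by pat_completeness auto

end

theory Submission
  imports Defs
begin

text \<open>
  With \<open>P\<^sub>i\<close> the sum of the parts before the \<open>i\<close>-th, the condition \<open>\<bar>s\<^sub>t\<bar> \<le> \<lambda>\<^sub>t\<close> says \<open>2 P\<^sub>t \<le> n \<le> 2 P\<^bsub>t+1\<^esub>\<close>, so the pivot block is
  one containing the midpoint. If \<open>s\<^sub>t = 0\<close>, this block consists of fixed points and can be cut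
  out. Otherwise let \<open>J\<close> be its first (if \<open>s\<^sub>t > 0\<close>) or last (if \<open>s\<^sub>t < 0\<close>) \<open>\<bar>s\<^sub>t\<bar>\<close> points. Then \<open>J\<close>
  and its image are disjoint, so \<open>J\<close> contains no orbit, and after closing the gap the
  first return map to the complement of \<open>J\<close> is the exchange with \<open>\<lambda>\<^sub>t\<close> replaced by \<open>\<lambda>\<^sub>t - \<bar>s\<^sub>t\<bar>\<close>.
  Parts equal to 0 do not affect the exchange, so deleting a part amounts to shrinking it to 0.
\<close>

section \<open>Orbits under first return maps and fixed points\<close>

lemma card_image_eq_if_same_fibres:
  assumes "\<And>x y. x \<in> A \<Longrightarrow> y \<in> A \<Longrightarrow> F x = F y \<longleftrightarrow> G x = G y"
  shows "card (F ` A) = card (G ` A)"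
proof -
  \<comment> \<open>Any preimage of a value of \<open>F\<close> may be chosen before applying
    \<open>G\<close>, because \<open>F\<close> and \<open>G\<close> identify the same pairs.\<close>
  have "bij_betw (\<lambda>u. G (inv_into A F u)) (F ` A) (G ` A)"
  proof (rule bij_betw_imageI)
    show "inj_on (\<lambda>u. G (inv_into A F u)) (F ` A)"
      by (intro inj_onI) (metis assms f_inv_into_f inv_into_into)
    have "G (inv_into A F (F x)) = G x" if "x \<in> A" for x
      using assms[of "inv_into A F (F x)" x] that by (simp add: f_inv_into_f inv_into_into)
    then show "(\<lambda>u. G (inv_into A F u)) ` F ` A = G ` A"
      by (simp add: image_image)
  qed
  then show ?thesis by (rule bij_betw_same_card)
qed

lemma orbit_eq_iff_mem:
  assumes "permutation f"
  shows "orbit f x = orbit f y \<longleftrightarrow> x \<in> orbit f y"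
  using assms by (metis cyclic_on_orbit' orbit_cyclic_eq3 permutation_self_in_orbit)

text \<open>
  Read through the embedding \<open>e\<close>, the map \<open>T'\<close> is the first return map of \<open>T\<close> to the
  complement of \<open>J\<close>; every excursion into \<open>J\<close> lasts a single step.
\<close>

lemma num_orbits_first_return:
  fixes T :: "'a \<Rightarrow> 'a" and T' :: "'b \<Rightarrow> 'b"
  assumes perm: "permutation T" "permutation T'"
    and maps: "\<And>x. x \<in> S' \<Longrightarrow> T' x \<in> S'"
    and inj: "inj_on e S'"
    and disj: "e ` S' \<inter> J = {}"
    and step: "\<And>x. x \<in> S' \<Longrightarrow> T (e x) = e (T' x) \<or> T (e x) \<in> J \<and> T (T (e x)) = e (T' x)"
    and leave: "\<And>z. z \<in> J \<Longrightarrow> T z \<in> e ` S'"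
  shows "num_orbits (e ` S' \<union> J) T = num_orbits S' T'"
proof -
  have sub: "orbit T' x \<subseteq> S'" if "x \<in> S'" for x
  proof
    fix y assume "y \<in> orbit T' x"
    then show "y \<in> S'" by induction (use that maps in auto)
  qed
  have fwd: "e y \<in> orbit T (e x)" if "y \<in> orbit T' x" "x \<in> S'" for x y
    using that(1)
  proof induction
    case base
    show ?case using step[OF that(2)] by (metis orbit.intros)
  next
    case (step y)
    then show ?case using assms(6)[of y] sub[OF that(2)] by (metis orbit.step subsetD)
  qed
  have bwd: "y \<in> orbit T' x" if "e y \<in> orbit T (e x)" "x \<in> S'" "y \<in> S'" for x y
  proof -
    have Tstep: "(T (e w) \<notin> J \<longrightarrow> T (e w) \<in> e ` orbit T' x) \<and>
        (T (e w) \<in> J \<longrightarrow> T (T (e w)) \<in> e ` orbit T' x)"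
      if "w \<in> S'" "T' w \<in> orbit T' x" for w
      using step[OF that(1)] that disj maps[OF that(1)] by auto
    \<comment> \<open>The invariant must also cover points of \<open>J\<close>, which are not images
      under \<open>e\<close>; they are represented by their successor, which has left
      \<open>J\<close> again.\<close>
    have "(z \<notin> J \<longrightarrow> z \<in> e ` orbit T' x) \<and> (z \<in> J \<longrightarrow> T z \<in> e ` orbit T' x)"
      if "z \<in> orbit T (e x)" for z
      using that
    proof induction
      case base
      show ?case using Tstep[OF \<open>x \<in> S'\<close>] by (simp add: orbit.base)
    next
      case (step z)
      show ?case
      proof (cases "z \<in> J")
        case True
        then show ?thesis using step leave[OF True] disj by auto
      next
        case False
        then obtain w where "z = e w" "w \<in> orbit T' x" using step by auto
        then show ?thesis using Tstep[of w] sub[OF \<open>x \<in> S'\<close>] by (auto intro: orbit.step)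
      qed
    qed
    from this[OF that(1)] have "e y \<in> e ` orbit T' x" using disj that(3) by auto
    then show ?thesis using inj sub[OF that(2)] that(3) by (metis inj_on_image_mem_iff)
  qed
  \<comment> \<open>Points of \<open>J\<close> contribute no new orbit: each shares its orbit with
    its successor, which lies in the image of \<open>e\<close>.\<close>
  have "orbit T z \<in> orbit T ` e ` S'" if "z \<in> J" for z
  proof -
    have "T z \<in> orbit T z" by (rule orbit.base)
    then have "orbit T (T z) = orbit T z" using orbit_eq_iff_mem[OF perm(1)] by blast
    then show ?thesis using leave[OF that] by (metis imageI)
  qed
  then have "orbit T ` (e ` S' \<union> J) = (\<lambda>x. orbit T (e x)) ` S'"
    by (auto simp: image_image)
  moreover have "card ((\<lambda>x. orbit T (e x)) ` S') = card (orbit T' ` S')"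
    by (rule card_image_eq_if_same_fibres)
      (use fwd bwd orbit_eq_iff_mem perm in metis)
  ultimately show ?thesis by (simp add: num_orbits_def)
qed

lemma num_orbits_fixed_points:
  assumes perm: "permutation T"
    and fin: "finite A" "finite J" and disj: "A \<inter> J = {}"
    and fixd: "\<And>z. z \<in> J \<Longrightarrow> T z = z"
  shows "num_orbits (A \<union> J) T = num_orbits A T + card J"
proof -
  have orb: "orbit T z = {z}" if "z \<in> J" for z
    using fixd[OF that] by (simp add: orbit_eq_singleton_iff)
  have "orbit T ` A \<inter> orbit T ` J = {}"
  proof -
    have "orbit T a \<noteq> orbit T z" if "a \<in> A" "z \<in> J" for a z
      using permutation_self_in_orbit[OF perm, of a] orb[OF that(2)] that disj by auto
    then show ?thesis by blast
  qed
  moreover have "card (orbit T ` J) = card J"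
    by (rule card_image) (auto intro!: inj_onI simp: orb)
  ultimately show ?thesis
    using fin by (simp add: num_orbits_def image_Un card_Un_disjoint)
qed

section \<open>Block endpoints and the exchange as a permutation\<close>

definition prefix_sum :: "nat list \<Rightarrow> nat \<Rightarrow> int" where
  "prefix_sum lam i = (\<Sum>j<i. int (lam ! j))"

lemma prefix_sum_0 [simp]: "prefix_sum lam 0 = 0"
  by (simp add: prefix_sum_def)

lemma prefix_sum_Suc: "prefix_sum lam (Suc i) = prefix_sum lam i + int (lam ! i)"
  by (simp add: prefix_sum_def)

lemma prefix_sum_mono: "i \<le> j \<Longrightarrow> prefix_sum lam i \<le> prefix_sum lam j"
  unfolding prefix_sum_def by (intro sum_mono2) auto

lemma prefix_sum_length: "prefix_sum lam (length lam) = int (sum_list lam)"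
  by (simp add: prefix_sum_def sum_list_sum_nth atLeast0LessThan)

lemma mem_block_iff: "x \<in> block lam i \<longleftrightarrow> prefix_sum lam i < x \<and> x \<le> prefix_sum lam (Suc i)"
  by (auto simp: block_def prefix_sum_def lessThan_Suc_atMost)

lemma shift_eq:
  assumes "i < length lam"
  shows "shift lam i = int (sum_list lam) - prefix_sum lam i - prefix_sum lam (Suc i)"
proof -
  have split: "{..<length lam} = {..<Suc i} \<union> {i<..<length lam}" using assms by auto
  have "(\<Sum>j<length lam. int (lam ! j))
      = (\<Sum>j<Suc i. int (lam ! j)) + (\<Sum>j\<in>{i<..<length lam}. int (lam ! j))"
    unfolding split by (rule sum.union_disjoint) auto
  then have "int (sum_list lam)
      = prefix_sum lam (Suc i) + (\<Sum>j\<in>{i<..<length lam}. int (lam ! j))"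
    by (metis prefix_sum_def prefix_sum_length)
  then show ?thesis unfolding shift_def prefix_sum_def by linarith
qed

lemma ex_block:
  assumes "0 < x" "x \<le> prefix_sum lam k"
  shows "\<exists>i<k. x \<in> block lam i"
  using assms(2)
proof (induction k)
  case 0
  then show ?case using assms(1) by simp
next
  case (Suc k)
  then show ?case by (cases "x \<le> prefix_sum lam k") (auto simp: mem_block_iff less_Suc_eq)
qed

lemma block_unique:
  assumes "x \<in> block lam i" "x \<in> block lam j"
  shows "i = j"
proof (rule ccontr)
  assume "i \<noteq> j"
  then consider "Suc i \<le> j" | "Suc j \<le> i" by linarith
  then show False
    using assms prefix_sum_mono[of "Suc i" j lam] prefix_sum_mono[of "Suc j" i lam]
    by cases (auto simp: mem_block_iff)
qed

lemma block_bounds: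
  assumes "x \<in> block lam i" "i < length lam"
  shows "1 \<le> x" "x \<le> int (sum_list lam)"
  using assms prefix_sum_mono[of 0 i lam] prefix_sum_mono[of "Suc i" "length lam" lam]
  by (auto simp: mem_block_iff prefix_sum_length)

lemma interval_exchange_block:
  assumes "x \<in> block lam i" "i < length lam"
  shows "interval_exchange lam x = x + int (sum_list lam) - prefix_sum lam i - prefix_sum lam (Suc i)"
proof -
  have "(THE i. i < length lam \<and> x \<in> block lam i) = i"
    using assms block_unique by blast
  then show ?thesis using assms by (auto simp: interval_exchange_def shift_eq)
qed

lemma interval_exchange_outside:
  assumes "x \<notin> {1..int (sum_list lam)}"
  shows "interval_exchange lam x = x"
proof -
  have "\<not> (\<exists>i<length lam. x \<in> block lam i)"
    using assms block_bounds by (meson atLeastAtMost_iff)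
  then show ?thesis unfolding interval_exchange_def by (rule if_not_P)
qed

lemma ex_block_of_mem:
  assumes "x \<in> {1..int (sum_list lam)}"
  obtains i where "i < length lam" "x \<in> block lam i"
  using ex_block[of x lam "length lam"] assms by (auto simp: prefix_sum_length)

lemma interval_exchange_mem:
  assumes "x \<in> {1..int (sum_list lam)}"
  shows "interval_exchange lam x \<in> {1..int (sum_list lam)}"
proof -
  obtain i where i: "i < length lam" "x \<in> block lam i" using ex_block_of_mem assms .
  then show ?thesis
    using prefix_sum_mono[of 0 i lam] prefix_sum_mono[of "Suc i" "length lam" lam]
    by (auto simp: interval_exchange_block mem_block_iff prefix_sum_length)
qed

text \<open>With P_i for \<open>prefix_sum lam i\<close> and n for the total, the integers in (P_i,
  P_(i+1)] are sent to those in (n - P_(i+1), n - P_i]. The blocks reappear in reversed order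
  without overlap, hence injectivity; finiteness gives surjectivity.\<close>

lemma interval_exchange_permutes: "interval_exchange lam permutes {1..int (sum_list lam)}"
proof (rule bij_imp_permutes)
  let ?S = "{1..int (sum_list lam)}"
  have "inj_on (interval_exchange lam) ?S"
  proof (rule inj_onI)
    fix x y assume xy: "x \<in> ?S" "y \<in> ?S" and eq: "interval_exchange lam x = interval_exchange lam y"
    obtain i where i: "i < length lam" "x \<in> block lam i" using ex_block_of_mem xy(1) .
    obtain j where j: "j < length lam" "y \<in> block lam j" using ex_block_of_mem xy(2) .
    consider "i = j" | "Suc i \<le> j" | "Suc j \<le> i" by linarith
    then show "x = y"
      using i j eq prefix_sum_mono[of "Suc i" j lam] prefix_sum_mono[of "Suc j" i lam]
      by cases (auto simp: interval_exchange_block mem_block_iff)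
  qed
  moreover have "interval_exchange lam ` ?S \<subseteq> ?S" using interval_exchange_mem by blast
  ultimately show "bij_betw (interval_exchange lam) ?S ?S"
    by (simp add: bij_betw_def endo_inj_surj)
qed (rule interval_exchange_outside)

lemma interval_exchange_permutation: "permutation (interval_exchange lam)"
  using interval_exchange_permutes permutation_permutes by blast

section \<open>Shrinking a part and deleting an empty one\<close>

lemma prefix_sum_update:
  assumes "t < length lam" "d \<le> lam ! t"
  shows "prefix_sum (lam[t := lam ! t - d]) i
    = (if i \<le> t then prefix_sum lam i else prefix_sum lam i - int d)"
  using assms
  by (induction i) (auto simp: prefix_sum_Suc nth_list_update not_less_eq_eq dest: le_antisym)

lemma sum_list_update_diff:
  assumes "t < length lam" "d \<le> lam ! t"
  shows "int (sum_list (lam[t := lam ! t - d])) = int (sum_list lam) - int d"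
  using prefix_sum_update[OF assms, of "length lam"] assms
  by (metis length_list_update linorder_not_less prefix_sum_length)

lemma prefix_sum_delete_part_zero:
  assumes "t < length lam" "lam ! t = 0"
  shows "prefix_sum (delete_part t lam) i = prefix_sum lam (if i \<le> t then i else Suc i)"
  using assms
  by (induction i)
    (auto simp: prefix_sum_Suc delete_part_def nth_append not_less_eq_eq min_def dest: le_antisym)

text \<open>A part 0 has an empty block, so deleting it only renumbers the later blocks; their
  endpoints and the total stay the same.\<close>

lemma interval_exchange_delete_part_zero:
  assumes t: "t < length lam" and zero: "lam ! t = 0"
  shows "sum_list (delete_part t lam) = sum_list lam"
    and "interval_exchange (delete_part t lam) = interval_exchange lam"
proof -
  have len: "length (delete_part t lam) = length lam - 1"
    using t by (simp add: delete_part_def)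
  note ps = prefix_sum_delete_part_zero[OF t zero]
  have mid: "prefix_sum lam (Suc t) = prefix_sum lam t"
    using zero by (simp add: prefix_sum_Suc)
  have "int (sum_list (delete_part t lam)) = int (sum_list lam)"
  proof (cases "length lam - 1 \<le> t")
    case True
    then have "length lam = Suc t" using t by simp
    then show ?thesis using ps[of "length lam - 1"] mid len
      by (metis diff_Suc_1 order_refl prefix_sum_length)
  next
    case False
    then show ?thesis using ps[of "length lam - 1"] len t
      by (metis Suc_diff_1 length_greater_0_conv list.size(3) not_less_zero prefix_sum_length)
  qed
  then show sum: "sum_list (delete_part t lam) = sum_list lam" by simp
  show "interval_exchange (delete_part t lam) = interval_exchange lam"
  proof
    fix x
    show "interval_exchange (delete_part t lam) x = interval_exchange lam x"
    proof (cases "x \<in> {1..int (sum_list lam)}")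
      case False
      then show ?thesis using sum by (simp add: interval_exchange_outside del: atLeastAtMost_iff)
    next
      case True
      then have "x \<in> {1..int (sum_list (delete_part t lam))}" by (simp add: sum)
      then obtain i where i: "i < length lam - 1" "x \<in> block (delete_part t lam) i"
        using ex_block_of_mem len by metis
      \<comment> \<open>Index of the same block in \<open>lam\<close>. For \<open>i = t\<close> the
        left endpoints agree by \<open>mid\<close>.\<close>
      let ?k = "if i < t then i else Suc i"
      have bounds: "prefix_sum (delete_part t lam) i = prefix_sum lam ?k"
        "prefix_sum (delete_part t lam) (Suc i) = prefix_sum lam (Suc ?k)"
        using ps[of i] ps[of "Suc i"] mid by auto
      have "x \<in> block lam ?k" using i(2) unfolding mem_block_iff bounds .
      moreover have "?k < length lam" using i(1) by auto
      ultimately show ?thesis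
        using i len sum bounds by (simp only: interval_exchange_block)
    qed
  qed
qed

section \<open>Existence of the pivot\<close>

lemma shift_le_part_iff:
  assumes "t < length lam"
  shows "\<bar>shift lam t\<bar> \<le> int (lam ! t) \<longleftrightarrow>
    2 * prefix_sum lam t \<le> int (sum_list lam) \<and> int (sum_list lam) \<le> 2 * prefix_sum lam (Suc t)"
  unfolding shift_eq[OF assms] prefix_sum_Suc by auto

text \<open>The partial sums climb from 0 to the total n, so some block is the first whose right
  endpoint reaches n/2; by minimality its left endpoint is at most n/2.\<close>

lemma ex_shift_le_part:
  assumes "composition lam"
  shows "\<exists>t<length lam. \<bar>shift lam t\<bar> \<le> int (lam ! t)"
proof -
  let ?n = "int (sum_list lam)"
  let ?P = "\<lambda>k. ?n \<le> 2 * prefix_sum lam (Suc k)"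
  have len: "length lam > 0" using assms by (simp add: composition_def)
  then have ex: "?P (length lam - 1)" by (simp add: prefix_sum_length)
  define t where "t = (LEAST k. ?P k)"
  have P: "?P t" unfolding t_def using ex by (rule LeastI)
  have "t \<le> length lam - 1" unfolding t_def using ex by (rule Least_le)
  then have t: "t < length lam" using len by linarith
  have "2 * prefix_sum lam t \<le> ?n"
  proof (cases t)
    case (Suc k)
    then have "\<not> ?P k" unfolding t_def by (metis lessI not_less_Least t_def)
    then show ?thesis using Suc by simp
  qed simp
  then show ?thesis using P t shift_le_part_iff by blast
qed

section \<open>First return after removing points of a block\<close>

lemma embedding_image:
  fixes c d n :: int
  assumes "0 \<le> d" "0 \<le> c" "c + d \<le> n"
  shows "(\<lambda>y. if y \<le> c then y else y + d) ` {1..n - d} = {1..n} - {c + 1..c + d}" (is "?e ` _ = _")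
proof (intro equalityI subsetI)
  fix x assume x: "x \<in> {1..n} - {c + 1..c + d}"
  show "x \<in> ?e ` {1..n - d}"
    by (rule image_eqI[of _ _ "if x \<le> c then x else x - d"]) (use x assms in auto)
qed (use assms in auto)

lemma embedding_inj: "0 \<le> (d :: int) \<Longrightarrow> inj_on (\<lambda>y. if y \<le> c then y else y + d) A"
  by (auto intro!: inj_onI split: if_splits)

text \<open>
  Removing \<open>d\<close> points after position \<open>c\<close> from the block \<open>t\<close> containing the midpoint. The three
  cases of \<open>cut\<close> are: the first \<open>d = s\<^sub>t\<close> points, the last \<open>d = -s\<^sub>t\<close> points, the whole block.
\<close>

lemma interval_exchange_first_return:
  fixes lam mu :: "nat list" and t d :: nat and c :: int
  assumes mu_def: "mu = lam[t := lam ! t - d]"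
    and e_def: "e = (\<lambda>y. if y \<le> c then y else y + int d)"
    and J_def: "J = {c + 1..c + int d}"
    and t: "t < length lam" and d: "d \<le> lam ! t"
    and cut: "shift lam t = int d \<and> c = prefix_sum lam t
      \<or> shift lam t = - int d \<and> c + int d = prefix_sum lam (Suc t)
      \<or> shift lam t = 0 \<and> c = prefix_sum lam t \<and> d = lam ! t"
  shows "e ` {1..int (sum_list mu)} = {1..int (sum_list lam)} - J"
    and "J \<subseteq> {1..int (sum_list lam)}"
    and "\<And>z. z \<in> J \<Longrightarrow> interval_exchange lam z = z + shift lam t"
    and "\<And>y. y \<in> {1..int (sum_list mu)} \<Longrightarrow>
      interval_exchange lam (e y) = e (interval_exchange mu y) \<or>
      interval_exchange lam (e y) \<in> J \<and>
      interval_exchange lam (interval_exchange lam (e y)) = e (interval_exchange mu y)"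
proof -
  let ?n = "int (sum_list lam)" and ?P = "prefix_sum lam"
  have Suc_t: "?P (Suc t) = ?P t + int (lam ! t)" by (rule prefix_sum_Suc)
  have c: "?P t \<le> c" "c + int d \<le> ?P (Suc t)" using cut d Suc_t by auto
  have P: "0 \<le> ?P t" "?P (Suc t) \<le> ?n"
    using prefix_sum_mono[of 0 t lam] prefix_sum_mono[of "Suc t" "length lam" lam] t
    by (auto simp: prefix_sum_length)
  have st: "shift lam t = ?n - ?P t - ?P (Suc t)" using shift_eq[OF t] .
  have n': "int (sum_list mu) = ?n - int d"
    unfolding mu_def by (rule sum_list_update_diff[OF t d])
  note P' = prefix_sum_update[OF t d, folded mu_def]
  show "e ` {1..int (sum_list mu)} = {1..?n} - J"
    unfolding n' e_def J_def by (rule embedding_image) (use c P in auto)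
  show "J \<subseteq> {1..?n}" using c P by (auto simp: J_def)
  show J: "interval_exchange lam z = z + shift lam t" if "z \<in> J" for z
  proof -
    have "z \<in> block lam t" using that c by (auto simp: J_def mem_block_iff)
    then show ?thesis using interval_exchange_block[OF _ t] st by simp
  qed
  fix y assume "y \<in> {1..int (sum_list mu)}"
  then obtain i where i: "i < length mu" "y \<in> block mu i" using ex_block_of_mem by blast
  then have il: "i < length lam" by (simp add: mu_def)
  have T'y: "interval_exchange mu y = y + ?n - int d - prefix_sum mu i - prefix_sum mu (Suc i)"
    using interval_exchange_block[OF i(2,1)] n' by simp
  have y: "prefix_sum mu i < y" "y \<le> prefix_sum mu (Suc i)" using i(2) by (auto simp: mem_block_iff)
  \<comment> \<open>Points of \<open>J\<close> move by \<open>shift lam t\<close>, so the second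
    application of the exchange is written as this addition; each case then becomes linear
    arithmetic.\<close>
  have ey: "e y \<in> block lam i \<and>
      (interval_exchange lam (e y) = e (interval_exchange mu y) \<or>
      interval_exchange lam (e y) \<in> J \<and>
      interval_exchange lam (e y) + shift lam t = e (interval_exchange mu y))"
  proof -
    \<comment> \<open>For \<open>i < t\<close> the point lies before the gap and \<open>e\<close>
      fixes it; for \<open>t < i\<close> it lies after and moves by \<open>d\<close>; for
      \<open>i = t\<close> the alternative in \<open>cut\<close> decides.\<close>
    consider "i < t" | "i = t" | "t < i" by linarith
    then show ?thesis
    proof cases
      case 1
      then have m: "?P (Suc i) \<le> ?P t" by (intro prefix_sum_mono) simp
      have Q: "prefix_sum mu i = ?P i" "prefix_sum mu (Suc i) = ?P (Suc i)" using P' 1 by auto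
      have "e y = y" using y Q m c by (simp add: e_def)
      moreover have "y \<in> block lam i" using y Q by (simp add: mem_block_iff)
      moreover have "interval_exchange lam y = y + ?n - ?P i - ?P (Suc i)"
        using interval_exchange_block calculation(2) il by blast
      ultimately show ?thesis
        using T'y cut y m c Q st Suc_t by (auto simp: e_def J_def)
    next
      case 2
      have Q: "prefix_sum mu i = ?P t" "prefix_sum mu (Suc i) = ?P (Suc t) - int d" using P' 2 by auto
      have b: "e y \<in> block lam i" using y Q c 2 by (auto simp: e_def mem_block_iff)
      have "interval_exchange lam (e y) = e y + ?n - ?P t - ?P (Suc t)"
        using interval_exchange_block[OF b il] 2 by simp
      then show ?thesis
        using b T'y cut y c Q st Suc_t by (auto simp: e_def J_def)
    next
      case 3
      then have m: "?P (Suc t) \<le> ?P i" by (intro prefix_sum_mono) simp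
      have Q: "prefix_sum mu i = ?P i - int d" "prefix_sum mu (Suc i) = ?P (Suc i) - int d"
        using P' 3 by auto
      have "e y = y + int d" using y Q m c by (simp add: e_def)
      moreover have b: "y + int d \<in> block lam i" using y Q by (simp add: mem_block_iff)
      moreover have "interval_exchange lam (y + int d) = y + int d + ?n - ?P i - ?P (Suc i)"
        using interval_exchange_block[OF b il] .
      ultimately show ?thesis
        using T'y cut y m c Q st Suc_t by (auto simp: e_def J_def)
    qed
  qed
  then show "interval_exchange lam (e y) = e (interval_exchange mu y) \<or>
      interval_exchange lam (e y) \<in> J \<and>
      interval_exchange lam (interval_exchange lam (e y)) = e (interval_exchange mu y)"
    using J by auto
qed

section \<open>Orbit counts under one reduction step\<close>

lemma num_orbits_shrink_part:
  fixes lam :: "nat list" and t :: nat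
  defines "d \<equiv> nat \<bar>shift lam t\<bar>"
  defines "mu \<equiv> lam[t := lam ! t - d]"
  assumes t: "t < length lam" and le: "\<bar>shift lam t\<bar> \<le> int (lam ! t)" and nz: "shift lam t \<noteq> 0"
  shows "num_orbits {1..int (sum_list lam)} (interval_exchange lam)
    = num_orbits {1..int (sum_list mu)} (interval_exchange mu)"
proof -
  \<comment> \<open>A positive shift removes the first \<open>d\<close> points of block
    \<open>t\<close>, a negative one the last \<open>d\<close>.\<close>
  define c where "c = (if 0 < shift lam t then prefix_sum lam t else prefix_sum lam (Suc t) - int d)"
  define e where "e = (\<lambda>y. if y \<le> c then y else y + int d)"
  define J where "J = {c + 1..c + int d}"
  let ?n = "int (sum_list lam)"
  have d: "d \<le> lam ! t" using le by (simp add: d_def)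
  have cut: "shift lam t = int d \<and> c = prefix_sum lam t
      \<or> shift lam t = - int d \<and> c + int d = prefix_sum lam (Suc t)
      \<or> shift lam t = 0 \<and> c = prefix_sum lam t \<and> d = lam ! t"
    using nz by (auto simp: c_def d_def)
  note fr = interval_exchange_first_return[OF mu_def[THEN meta_eq_to_obj_eq] e_def J_def t d cut]
  have "num_orbits (e ` {1..int (sum_list mu)} \<union> J) (interval_exchange lam)
      = num_orbits {1..int (sum_list mu)} (interval_exchange mu)"
  proof (rule num_orbits_first_return)
    show "inj_on e {1..int (sum_list mu)}" unfolding e_def by (rule embedding_inj) simp
    show "e ` {1..int (sum_list mu)} \<inter> J = {}" using fr(1) by auto
    fix z assume z: "z \<in> J"
    have "interval_exchange lam z \<in> {1..?n}" using z fr(2) interval_exchange_mem by blast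
    \<comment> \<open>\<open>J\<close> is an interval of exactly \<open>d\<close> points translated
      by \<open>d\<close> to one side, hence disjoint from its image.\<close>
    moreover have "interval_exchange lam z \<notin> J"
      using z nz fr(3)[OF z] by (auto simp: J_def d_def)
    ultimately show "interval_exchange lam z \<in> e ` {1..int (sum_list mu)}" using fr(1) by simp
  qed (fact interval_exchange_permutation interval_exchange_mem fr(4))+
  moreover have "e ` {1..int (sum_list mu)} \<union> J = {1..?n}" using fr(1,2) by auto
  ultimately show ?thesis by simp
qed

text \<open>The whole block is fixed pointwise and yields \<open>lam ! t\<close> singleton orbits.
  Its complement is invariant, and there the exchange is conjugate to that of
  \<open>mu\<close>.\<close>

lemma num_orbits_remove_fixed_part:
  fixes lam :: "nat list" and t :: nat
  defines "mu \<equiv> lam[t := 0]"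
  assumes t: "t < length lam" and zero: "shift lam t = 0"
  shows "num_orbits {1..int (sum_list lam)} (interval_exchange lam)
    = lam ! t + num_orbits {1..int (sum_list mu)} (interval_exchange mu)"
proof -
  define c where "c = prefix_sum lam t"
  define e where "e = (\<lambda>y. if y \<le> c then y else y + int (lam ! t))"
  define J where "J = {c + 1..c + int (lam ! t)}"
  let ?n = "int (sum_list lam)"
  have mu: "mu = lam[t := lam ! t - lam ! t]" by (simp add: mu_def)
  have cut: "shift lam t = int (lam ! t) \<and> c = prefix_sum lam t
      \<or> shift lam t = - int (lam ! t) \<and> c + int (lam ! t) = prefix_sum lam (Suc t)
      \<or> shift lam t = 0 \<and> c = prefix_sum lam t \<and> lam ! t = lam ! t"
    using zero by (simp add: c_def)
  note fr = interval_exchange_first_return[OF mu e_def J_def t order_refl cut]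
  have fixd: "interval_exchange lam z = z" if "z \<in> J" for z using fr(3)[OF that] zero by simp
  \<comment> \<open>No point outside \<open>J\<close> enters it, so the first return argument
    applies with an empty set of excursions.\<close>
  have "num_orbits (e ` {1..int (sum_list mu)} \<union> {}) (interval_exchange lam)
      = num_orbits {1..int (sum_list mu)} (interval_exchange mu)"
  proof (rule num_orbits_first_return)
    show "inj_on e {1..int (sum_list mu)}" unfolding e_def by (rule embedding_inj) simp
    fix y assume y: "y \<in> {1..int (sum_list mu)}"
    \<comment> \<open>A point landing in \<open>J\<close> would stay there, but the return point
      lies outside; this rules out the second alternative of \<open>fr(4)\<close>.\<close>
    have "e (interval_exchange mu y) \<notin> J" using fr(1) interval_exchange_mem[OF y] by blast
    then show "interval_exchange lam (e y) = e (interval_exchange mu y) \<or>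
      interval_exchange lam (e y) \<in> {} \<and>
      interval_exchange lam (interval_exchange lam (e y)) = e (interval_exchange mu y)"
      using fr(4)[OF y] fixd by metis
  qed (simp_all add: interval_exchange_permutation interval_exchange_mem del: atLeastAtMost_iff)
  moreover have "num_orbits (e ` {1..int (sum_list mu)} \<union> J) (interval_exchange lam)
      = num_orbits (e ` {1..int (sum_list mu)}) (interval_exchange lam) + card J"
  proof (rule num_orbits_fixed_points)
    show "e ` {1..int (sum_list mu)} \<inter> J = {}" using fr(1) by auto
  qed (use fixd in \<open>simp_all add: interval_exchange_permutation J_def\<close>)
  moreover have "e ` {1..int (sum_list mu)} \<union> J = {1..?n}" using fr(1,2) by auto
  ultimately show ?thesis by (simp add: J_def)
qed

text \<open>Links the orbit counts, obtained by setting a part to 0, with the recursion, which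
  deletes that part.\<close>

lemma num_orbits_clear_part:
  assumes "t < length lam"
  shows "num_orbits {1..int (sum_list (lam[t := 0]))} (interval_exchange (lam[t := 0]))
    = num_orbits {1..int (sum_list (delete_part t lam))} (interval_exchange (delete_part t lam))"
proof -
  have "delete_part t (lam[t := 0]) = delete_part t lam" by (simp add: delete_part_def)
  then show ?thesis
    using interval_exchange_delete_part_zero[of t "lam[t := 0]"] assms by simp
qed

section \<open>Termination and evaluation of the recursion\<close>

lemma sum_list_delete_part:
  assumes "t < length lam"
  shows "sum_list lam = lam ! t + sum_list (delete_part t lam)"
proof -
  have "sum_list (take t lam @ lam ! t # drop (Suc t) lam) = lam ! t + sum_list (delete_part t lam)"
    by (simp add: delete_part_def)
  then show ?thesis using id_take_nth_drop[OF assms] by argo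
qed

lemma sum_list_update_less:
  fixes lam :: "nat list"
  assumes "t < length lam" "0 < d" "d \<le> lam ! t"
  shows "sum_list (lam[t := lam ! t - d]) < sum_list lam"
  using sum_list_update_diff[OF assms(1,3)] assms(2) by linarith

lemma composition_delete_part:
  assumes "composition lam" "t < length lam" "length lam \<noteq> 1"
  shows "composition (delete_part t lam)"
proof -
  have "length (delete_part t lam) > 0" using assms by (simp add: delete_part_def)
  moreover have "set (delete_part t lam) \<subseteq> set lam"
    by (auto simp: delete_part_def dest: in_set_takeD in_set_dropD)
  ultimately show ?thesis using assms(1) by (auto simp: composition_def)
qed

lemma composition_update:
  assumes "composition lam" "0 < k"
  shows "composition (lam[t := k])"
  using assms set_update_subset_insert[of lam t k] by (auto simp: composition_def)

lemma
  assumes "composition lam"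
  shows pivot_less: "pivot lam < length lam"
    and shift_pivot_le: "\<bar>shift lam (pivot lam)\<bar> \<le> int (lam ! pivot lam)"
proof -
  have "pivot lam < length lam \<and> \<bar>shift lam (pivot lam)\<bar> \<le> int (lam ! pivot lam)"
    unfolding pivot_def using ex_shift_le_part[OF assms] by (rule LeastI_ex)
  then show "pivot lam < length lam" "\<bar>shift lam (pivot lam)\<bar> \<le> int (lam ! pivot lam)" by auto
qed

text \<open>Deletion removes a positive part and happens only when another part remains; otherwise a
  nonzero amount smaller than the pivot part is subtracted.\<close>

lemma comp_f_rel_composition:
  assumes "comp_f_rel mu lam" "composition lam"
  shows "composition mu" "sum_list mu < sum_list lam"
proof -
  let ?t = "pivot lam"
  note t = pivot_less[OF assms(2)] and le = shift_pivot_le[OF assms(2)]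
  have pos: "0 < lam ! ?t" using t assms(2) by (simp add: composition_def)
  have "composition mu \<and> sum_list mu < sum_list lam"
    using assms(1)
  proof cases
    case 1
    then show ?thesis
      using composition_delete_part[OF assms(2) t] sum_list_delete_part[OF t] pos by simp
  next
    case 2
    then show ?thesis
      using composition_delete_part[OF assms(2) t] sum_list_delete_part[OF t] pos by simp
  next
    case 3
    let ?d = "nat \<bar>shift lam ?t\<bar>"
    have "0 < ?d" "?d < lam ! ?t" using 3 le by auto
    then show ?thesis
      using 3 composition_update[OF assms(2), of "lam ! ?t - ?d" ?t]
        sum_list_update_less[OF t, of ?d] by simp
  qed
  then show "composition mu" "sum_list mu < sum_list lam" by auto
qed

text \<open>The domain is the accessible part of \<open>comp_f_rel\<close>, and the sum of the parts
  decreases along it. This descent is established for compositions, so that property is passed on to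
  the called lists.\<close>

lemma comp_f_terminates: "composition lam \<Longrightarrow> comp_f_dom lam"
proof (induction "sum_list lam" arbitrary: lam rule: less_induct)
  case less
  show ?case by (rule accpI) (use comp_f_rel_composition less in blast)
qed

lemma comp_f_eq_num_orbits:
  "composition lam \<Longrightarrow> comp_f lam = num_orbits {1..int (sum_list lam)} (interval_exchange lam)"
proof (induction "sum_list lam" arbitrary: lam rule: less_induct)
  case less
  let ?t = "pivot lam" and ?N = "\<lambda>lam. num_orbits {1..int (sum_list lam)} (interval_exchange lam)"
  let ?d = "nat \<bar>shift lam ?t\<bar>"
  note t = pivot_less[OF less.prems] and le = shift_pivot_le[OF less.prems]
  have pos: "0 < lam ! ?t" using t less.prems by (simp add: composition_def)
  note eq = comp_f.psimps[OF comp_f_terminates[OF less.prems]]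
  have del: "comp_f (delete_part ?t lam) = ?N (delete_part ?t lam)" if "length lam \<noteq> 1"
    using less.hyps composition_delete_part[OF less.prems t that] sum_list_delete_part[OF t] pos
    by simp
  consider "length lam = 1" | "length lam \<noteq> 1" "shift lam ?t = 0"
    | "length lam \<noteq> 1" "shift lam ?t \<noteq> 0" "int (lam ! ?t) = \<bar>shift lam ?t\<bar>"
    | "length lam \<noteq> 1" "shift lam ?t \<noteq> 0" "int (lam ! ?t) \<noteq> \<bar>shift lam ?t\<bar>" by blast
  then show ?case
  proof cases
    case 1
    then obtain a where a: "lam = [a]" by (auto simp: length_Suc_conv)
    \<comment> \<open>A single block is fixed pointwise, and deleting it leaves the empty list,
      which has no orbits.\<close>
    have "shift lam 0 = 0" using a by (simp add: shift_def)
    then have "?N lam = lam ! 0 + ?N (delete_part 0 lam)"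
      using num_orbits_remove_fixed_part[of 0 lam] num_orbits_clear_part[of 0 lam] a by simp
    then show ?thesis using eq 1 a by (simp add: delete_part_def num_orbits_def)
  next
    case 2
    then show ?thesis
      using eq del num_orbits_remove_fixed_part[OF t] num_orbits_clear_part[OF t] by simp
  next
    case 3
    \<comment> \<open>The subtraction exhausts the part, so the shrunken list has a 0 there that may
      be deleted.\<close>
    then have "?d = lam ! ?t" by simp
    then show ?thesis
      using 3 eq del num_orbits_shrink_part[OF t le] num_orbits_clear_part[OF t] by simp
  next
    case 4
    let ?mu = "lam[?t := lam ! ?t - ?d]"
    have "0 < ?d" "?d < lam ! ?t" using 4 le by auto
    then have "composition ?mu" "sum_list ?mu < sum_list lam"
      using composition_update[OF less.prems, of "lam ! ?t - ?d" ?t]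
        sum_list_update_less[OF t, of ?d] by simp_all
    then have "comp_f ?mu = ?N ?mu" using less.hyps by blast
    then show ?thesis using 4 eq num_orbits_shrink_part[OF t le] by simp
  qed
qed

theorem theorem6:
  fixes lam :: "nat list"
  assumes "composition lam"
  shows "(\<exists>t<length lam. \<bar>shift lam t\<bar> \<le> int (lam ! t))
       \<and> (\<forall>mu. comp_f_rel mu lam \<longrightarrow> composition mu)
       \<and> comp_f_dom lam
       \<and> comp_f lam = num_orbits {1..int (sum_list lam)} (interval_exchange lam)"
  using assms ex_shift_le_part comp_f_rel_composition(1) comp_f_terminates comp_f_eq_num_orbits
  by blast

end
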